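(* Let $k\ge0$ and $d\ge1$ be integers. The map $\mathcal{T}:C^k(S^1,\mathbb{R}^d)\to C^k(\mathbf{F}_2(S^1),\mathbb{R})$, $\gamma\mapsto\mathcal{T}_\gamma$, is continuous when both spaces carry the Whitney $C^k$-topology.
   Context: $\mathbf{F}_2(S^1)$ is the set of non-empty subsets $\{z_1,z_2\}\subset S^1$ of cardinality at most $2$, with the quotient topology from $S^1\times S^1$. It is a compact smooth 2-manifold with boundary (a Möbius band): with $e(t)=e^{2\pi \mathrm{i} t}$, the map $(x_1,x_2)\mapsto\{e(x_1),e(x_2)\}$ from the strip $\{(x_1,x_2)\in\mathbb{R}^2:0\le x_2-x_1\le 1\}$ is its universal covering, with deck group generated by $(x_1,x_2)\mapsto(x_2,x_1+1)$, and the smooth structure is the one making this a local diffeomorphism. $\mathcal{T}_\gamma(\{z_1,z_2\})=\tfrac12\|\gamma(z_1)-\gamma(z_2)\|^2$; it is $C^k$ if $\gamma$ is. Since the domain manifolds are compact, the Whitney (strong) $C^k$-topology coincides with the weak one: uniform convergence, in charts and on compact subsets, of all derivatives of order $0,\dots,k$. *)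

theory Defs
  imports "HOL-Analysis.Analysis"
begin

section \<open>Differentiability classes\<close>

text \<open>Only meant for open \<open>U\<close>; quantifying over all directions \<open>v\<close> makes the recursion
  stay within functions from \<open>'a\<close> to \<open>'b\<close>.\<close>

fun Ck_open :: "nat \<Rightarrow> 'a::euclidean_space set \<Rightarrow> ('a \<Rightarrow> 'b::real_normed_vector) \<Rightarrow> bool" where
  "Ck_open 0 U f \<longleftrightarrow> continuous_on U f"
| "Ck_open (Suc k) U f \<longleftrightarrow>
     (\<forall>x\<in>U. f differentiable (at x)) \<and>
     (\<forall>v. Ck_open k U (\<lambda>x. frechet_derivative f (at x) v))"

text \<open>The usual convention for domains with boundary: \<open>f\<close> is \<open>C\<^sup>k\<close> on \<open>S\<close> if near every point
  of \<open>S\<close> it extends to a \<open>C\<^sup>k\<close> function on an open subset of the ambient space.\<close>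

definition Ck_on :: "nat \<Rightarrow> 'a::euclidean_space set \<Rightarrow> ('a \<Rightarrow> 'b::real_normed_vector) \<Rightarrow> bool" where
  "Ck_on k S f \<longleftrightarrow>
     (\<forall>x\<in>S. \<exists>U g. open U \<and> x \<in> U \<and> Ck_open k U g \<and> (\<forall>y\<in>U \<inter> S. g y = f y))"

text \<open>Iterated directional derivatives relative to \<open>S\<close>. They are used for \<open>S = UNIV\<close> and for the
  closed strip below; in both cases derivatives within \<open>S\<close> are unique at every point of \<open>S\<close>, and
  on the boundary they agree with the derivatives of any local \<open>C\<^sup>k\<close> extension.\<close>

fun iter_deriv :: "'a::euclidean_space set \<Rightarrow> 'a list \<Rightarrow> ('a \<Rightarrow> 'b::real_normed_vector) \<Rightarrow> 'a \<Rightarrow> 'b" where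
  "iter_deriv S [] f = f"
| "iter_deriv S (v # vs) f = (\<lambda>x. frechet_derivative (iter_deriv S vs f) (at x within S) v)"


section \<open>Spaces of maps on a manifold presented by a covering\<close>

text \<open>A manifold (possibly with boundary) \<open>M\<close> is given by a surjective map \<open>p\<close> from \<open>S\<close> onto \<open>M\<close>
  that is declared to be a local diffeomorphism. Its charts are the inverses of \<open>p\<close> on relatively
  open sets \<open>V\<close> on which \<open>p\<close> is injective, so \<open>f \<circ> p\<close> restricted to \<open>V\<close> is \<open>f\<close> in such a chart.
  Maps on \<open>M\<close> are represented by functions that are undefined outside \<open>M\<close>.\<close>

definition Ck_maps ::
  "nat \<Rightarrow> 'a::euclidean_space set \<Rightarrow> ('a \<Rightarrow> 'm) \<Rightarrow> 'm set \<Rightarrow> ('m \<Rightarrow> 'b::real_normed_vector) set" where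
  "Ck_maps k S p M = {f \<in> extensional M. Ck_on k S (f \<circ> p)}"

definition Ck_nbhd ::
  "nat \<Rightarrow> 'a::euclidean_space set \<Rightarrow> ('a \<Rightarrow> 'm) \<Rightarrow> 'm set \<Rightarrow> ('m \<Rightarrow> 'b::real_normed_vector)
    \<Rightarrow> 'a set \<Rightarrow> real \<Rightarrow> ('m \<Rightarrow> 'b) set" where
  "Ck_nbhd k S p M f K \<epsilon> =
     {g \<in> Ck_maps k S p M.
        \<forall>vs. set vs \<subseteq> Basis \<and> length vs \<le> k \<longrightarrow>
          (\<forall>x\<in>K. norm (iter_deriv S vs (g \<circ> p) x - iter_deriv S vs (f \<circ> p) x) < \<epsilon>)}"

text \<open>The topology of uniform convergence, in charts and on compact subsets, of all partial
  derivatives of order at most \<open>k\<close>. For compact \<open>M\<close> this weak topology is the Whitney (strong)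
  \<open>C\<^sup>k\<close>-topology.\<close>

definition whitney_topology ::
  "nat \<Rightarrow> 'a::euclidean_space set \<Rightarrow> ('a \<Rightarrow> 'm) \<Rightarrow> 'm set \<Rightarrow> ('m \<Rightarrow> 'b::real_normed_vector) topology" where
  "whitney_topology k S p M = topology_generated_by
     {Ck_nbhd k S p M f K \<epsilon> | f V K \<epsilon>.
        f \<in> Ck_maps k S p M \<and>
        openin (top_of_set S) V \<and> inj_on p V \<and>
        compact K \<and> K \<subseteq> V \<and> 0 < \<epsilon>}"

lemma topspace_whitney_topology:
  "topspace (whitney_topology k S p M :: ('m \<Rightarrow> 'b::real_normed_vector) topology) = Ck_maps k S p M"
proof -
  have 1: "Ck_nbhd k S p M f {} 1 = Ck_maps k S p M" for f :: "'m \<Rightarrow> 'b"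
    by (auto simp: Ck_nbhd_def)
  have "f \<in> topspace (whitney_topology k S p M)" if "f \<in> Ck_maps k S p M" for f :: "'m \<Rightarrow> 'b"
  proof -
    have "openin (top_of_set S) {} \<and> inj_on p {} \<and> compact {} \<and> ({}::'a set) \<subseteq> {} \<and> (0::real) < 1"
      by simp
    then show ?thesis
      using that 1[of f]
      unfolding whitney_topology_def topology_generated_by_topspace Union_iff mem_Collect_eq
      by blast
  qed
  then show ?thesis
    by (auto simp: whitney_topology_def topology_generated_by_topspace Ck_nbhd_def)
qed


section \<open>The circle and its second finite subset space\<close>

abbreviation S1 :: "complex set" where
  "S1 \<equiv> sphere 0 1"

definition circ_exp :: "real \<Rightarrow> complex" where
  "circ_exp t = exp (2 * of_real pi * \<i> * of_real t)"

definition F2 :: "complex set set" where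
  "F2 = {w. w \<subseteq> S1 \<and> w \<noteq> {} \<and> finite w \<and> card w \<le> 2}"

definition strip :: "(real \<times> real) set" where
  "strip = {(x1, x2). 0 \<le> x2 - x1 \<and> x2 - x1 \<le> 1}"

definition F2_cover :: "real \<times> real \<Rightarrow> complex set" where
  "F2_cover = (\<lambda>(x1, x2). {circ_exp x1, circ_exp x2})"

definition Ck_S1_topology :: "nat \<Rightarrow> (complex \<Rightarrow> real ^ 'd::finite) topology" where
  "Ck_S1_topology k = whitney_topology k UNIV circ_exp S1"

definition Ck_F2_topology :: "nat \<Rightarrow> (complex set \<Rightarrow> real) topology" where
  "Ck_F2_topology k = whitney_topology k strip F2_cover F2"

definition T_map :: "(complex \<Rightarrow> real ^ 'd::finite) \<Rightarrow> complex set \<Rightarrow> real" where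
  "T_map \<gamma> = (\<lambda>w\<in>F2. THE r. \<exists>z1 z2. w = {z1, z2} \<and> r = 1 / 2 * (norm (\<gamma> z1 - \<gamma> z2))\<^sup>2)"

lemma T_map_pair:
  assumes "z1 \<in> S1" "z2 \<in> S1"
  shows "T_map \<gamma> {z1, z2} = 1 / 2 * (norm (\<gamma> z1 - \<gamma> z2))\<^sup>2"
proof -
  have "{z1, z2} \<in> F2"
    using assms by (auto simp: F2_def card_insert_if)
  moreover have "(THE r. \<exists>a b. {z1, z2} = {a, b} \<and> r = 1 / 2 * (norm (\<gamma> a - \<gamma> b))\<^sup>2)
      = 1 / 2 * (norm (\<gamma> z1 - \<gamma> z2))\<^sup>2"
    by (rule the_equality) (auto simp: doubleton_eq_iff norm_minus_commute)
  ultimately show ?thesis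
    by (simp add: T_map_def)
qed

lemma circ_exp_cis: "circ_exp t = cis (2 * pi * t)"
  by (simp add: circ_exp_def cis_conv_exp mult_ac)

lemma circ_exp_surj: "circ_exp ` UNIV = S1"
proof
  show "circ_exp ` UNIV \<subseteq> S1"
    by (auto simp: circ_exp_cis)
  show "S1 \<subseteq> circ_exp ` UNIV"
  proof
    fix z :: complex assume "z \<in> S1"
    then have "z = circ_exp (Arg z / (2 * pi))"
      using cis_Arg[of z] by (cases "z = 0") (simp_all add: circ_exp_cis sgn_eq)
    then show "z \<in> circ_exp ` UNIV" by blast
  qed
qed

lemma circ_exp_add_int: "circ_exp (t + of_int n) = circ_exp t"
  using cis_multiple_2pi[of "of_int n"] by (simp add: circ_exp_cis distrib_left flip: cis_mult)

lemma F2_cover_surj: "F2_cover ` strip = F2"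
proof
  show "F2_cover ` strip \<subseteq> F2"
    using circ_exp_surj by (auto simp: F2_cover_def F2_def card_insert_if)
  show "F2 \<subseteq> F2_cover ` strip"
  proof
    fix w assume w: "w \<in> F2"
    then obtain z1 z2 where z: "w = {z1, z2}" "z1 \<in> S1" "z2 \<in> S1"
    proof -
      have "card w = 1 \<or> card w = 2"
        using w card_gt_0_iff[of w] by (auto simp: F2_def)
      then show ?thesis
        using w that by (fastforce simp: F2_def card_1_singleton_iff card_2_iff)
    qed
    then obtain a b where ab: "z1 = circ_exp a" "z2 = circ_exp b"
      using circ_exp_surj by blast
    have "circ_exp (b + of_int (- \<lfloor>b - a\<rfloor>)) = z2"
      using ab circ_exp_add_int by metis
    moreover have "(a, b + of_int (- \<lfloor>b - a\<rfloor>)) \<in> strip"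
      unfolding strip_def by simp linarith
    ultimately show "w \<in> F2_cover ` strip"
      using z ab by (intro image_eqI[of _ _ "(a, b + of_int (- \<lfloor>b - a\<rfloor>))"])
        (simp_all add: F2_cover_def)
  qed
qed

end

theory Submission
  imports Defs
begin

text \<open>In the covering coordinates, with \<open>u = \<gamma> \<circ> circ_exp\<close>, the map \<open>T_map \<gamma>\<close> is
  \<open>(x, y) \<mapsto> \<bar>u x - u y\<bar>\<^sup>2 / 2\<close>, which makes sense on the whole plane, so that derivatives within
  the strip are ordinary partial derivatives. By polarisation the difference of the maps of \<open>u\<close>
  and \<open>w\<close> is half the inner product of the chords of \<open>u + w\<close> and \<open>u - w\<close>; the Leibniz rule bounds
  its derivatives by a constant times the \<open>C\<^sup>k\<close>-size of \<open>u - w\<close> on the coordinate projections of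
  the compact set in question. Such a bound is an open condition on \<open>\<gamma>\<close>, although these
  projections need not lie in the domain of a single chart.\<close>

section \<open>Functions of class \<open>C\<^sup>k\<close> on open sets\<close>

lemma Ck_open_imp_continuous_on: "Ck_open k U f \<Longrightarrow> continuous_on U f"
  by (cases k)
    (auto intro!: continuous_at_imp_continuous_on differentiable_imp_continuous_within)

lemma Ck_open_SucD: "Ck_open (Suc k) U f \<Longrightarrow> Ck_open k U f"
proof (induction k arbitrary: f)
  case 0
  then show ?case using Ck_open_imp_continuous_on Ck_open.simps(1) by blast
next
  case (Suc k)
  then show ?case
    by (metis Ck_open.simps(2))
qed

text \<open>On an open set the derivative at a point depends only on values inside the set, so
  agreement on \<open>U\<close> passes to every directional derivative and the induction goes
  through.\<close>

lemma Ck_open_cong: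
  assumes "open U" "\<And>x. x \<in> U \<Longrightarrow> f x = g x" "Ck_open k U f"
  shows "Ck_open k U g"
  using assms(2,3)
proof (induction k arbitrary: f g)
  case 0
  then show ?case by (simp cong: continuous_on_cong)
next
  case (Suc k)
  have deriv: "(g has_derivative frechet_derivative f (at x)) (at x)" if "x \<in> U" for x
  proof (rule has_derivative_transform_within_open[OF _ assms(1) that])
    show "(f has_derivative frechet_derivative f (at x)) (at x)"
      using Suc.prems that by (simp add: frechet_derivative_works)
  qed (use Suc.prems in auto)
  have "Ck_open k U (\<lambda>x. frechet_derivative g (at x) v)" for v
  proof (rule Suc.IH)
    show "Ck_open k U (\<lambda>x. frechet_derivative f (at x) v)"
      using Suc.prems by simp
    show "frechet_derivative f (at x) v = frechet_derivative g (at x) v" if "x \<in> U" for x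
      using frechet_derivative_at[OF deriv[OF that]] by simp
  qed
  then show ?case using deriv by (auto simp: differentiable_def)
qed

text \<open>A neighbourhood that works for \<open>f\<close> at order \<open>Suc k\<close> also works
  for each directional derivative at order \<open>k\<close>, so neighbourhoods are never
  shrunk.\<close>

lemma Ck_open_local:
  assumes "\<And>x. x \<in> S \<Longrightarrow> \<exists>U. open U \<and> x \<in> U \<and> Ck_open k U f"
  shows "Ck_open k S f"
  using assms
proof (induction k arbitrary: f)
  case 0
  then have "isCont f x" if "x \<in> S" for x
    using that by (metis Ck_open.simps(1) continuous_on_eq_continuous_at)
  then show ?case by (simp add: continuous_at_imp_continuous_on)
next
  case (Suc k)
  have "Ck_open k S (\<lambda>x. frechet_derivative f (at x) v)" for v
    by (rule Suc.IH) (use Suc.prems in fastforce)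
  then show ?case using Suc.prems by fastforce
qed

text \<open>Without a boundary, a local extension coincides with the function on a full open
  neighbourhood.\<close>

lemma Ck_on_UNIV_imp_Ck_open:
  assumes "Ck_on k UNIV f"
  shows "Ck_open k UNIV f"
proof (rule Ck_open_local)
  fix x :: 'a
  obtain U g where "open U" "x \<in> U" "Ck_open k U g" "\<forall>y\<in>U. g y = f y"
    using assms unfolding Ck_on_def by (metis Int_UNIV_right UNIV_I)
  then show "\<exists>U. open U \<and> x \<in> U \<and> Ck_open k U f"
    using Ck_open_cong[of U g f k] by blast
qed

section \<open>Linear combinations, inner products and linear substitutions\<close>

lemma frechet_derivative_lincomb:
  assumes "f differentiable (at x)" "g differentiable (at x)"
  shows "(\<lambda>x. a *\<^sub>R f x + b *\<^sub>R g x) differentiable (at x)"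
    and "frechet_derivative (\<lambda>x. a *\<^sub>R f x + b *\<^sub>R g x) (at x) v =
      a *\<^sub>R frechet_derivative f (at x) v + b *\<^sub>R frechet_derivative g (at x) v"
proof -
  have "((\<lambda>x. a *\<^sub>R f x + b *\<^sub>R g x) has_derivative
      (\<lambda>v. a *\<^sub>R frechet_derivative f (at x) v + b *\<^sub>R frechet_derivative g (at x) v)) (at x)"
    using assms by (intro derivative_intros) (auto simp: frechet_derivative_works)
  then show "(\<lambda>x. a *\<^sub>R f x + b *\<^sub>R g x) differentiable (at x)"
    "frechet_derivative (\<lambda>x. a *\<^sub>R f x + b *\<^sub>R g x) (at x) v =
      a *\<^sub>R frechet_derivative f (at x) v + b *\<^sub>R frechet_derivative g (at x) v"
    by (simp_all add: differentiable_def frechet_derivative_at[symmetric] exI)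
qed

lemma Ck_open_lincomb:
  assumes "open U" "Ck_open k U f" "Ck_open k U g"
  shows "Ck_open k U (\<lambda>x. a *\<^sub>R f x + b *\<^sub>R g x)"
  using assms(2,3)
proof (induction k arbitrary: f g)
  case 0
  then show ?case by (auto intro!: continuous_intros)
next
  case (Suc k)
  have "Ck_open k U (\<lambda>x. frechet_derivative (\<lambda>x. a *\<^sub>R f x + b *\<^sub>R g x) (at x) v)" for v
    by (rule Ck_open_cong[OF assms(1) _ Suc.IH])
      (use Suc.prems in \<open>auto simp: frechet_derivative_lincomb\<close>)
  then show ?case using Suc.prems by (auto simp: frechet_derivative_lincomb)
qed

lemma Ck_open_add:
  "open U \<Longrightarrow> Ck_open k U f \<Longrightarrow> Ck_open k U g \<Longrightarrow> Ck_open k U (\<lambda>x. f x + g x)"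
  using Ck_open_lincomb[of U k f g 1 1] by simp

lemma Ck_open_diff:
  "open U \<Longrightarrow> Ck_open k U f \<Longrightarrow> Ck_open k U g \<Longrightarrow> Ck_open k U (\<lambda>x. f x - g x)"
  using Ck_open_lincomb[of U k f g 1 "-1"] by simp

lemma frechet_derivative_inner:
  fixes f g :: "'a::real_normed_vector \<Rightarrow> 'b::real_inner"
  assumes "f differentiable (at x)" "g differentiable (at x)"
  shows "(\<lambda>x. f x \<bullet> g x) differentiable (at x)"
    and "frechet_derivative (\<lambda>x. f x \<bullet> g x) (at x) v =
      f x \<bullet> frechet_derivative g (at x) v + frechet_derivative f (at x) v \<bullet> g x"
proof -
  have "((\<lambda>x. f x \<bullet> g x) has_derivative
      (\<lambda>v. f x \<bullet> frechet_derivative g (at x) v + frechet_derivative f (at x) v \<bullet> g x)) (at x)"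
    using assms by (intro has_derivative_inner) (auto simp: frechet_derivative_works)
  then show "(\<lambda>x. f x \<bullet> g x) differentiable (at x)"
    "frechet_derivative (\<lambda>x. f x \<bullet> g x) (at x) v =
      f x \<bullet> frechet_derivative g (at x) v + frechet_derivative f (at x) v \<bullet> g x"
    by (simp_all add: differentiable_def frechet_derivative_at[symmetric] exI)
qed

text \<open>The product rule pairs one factor with a derivative of the other. The underived factor
  has an order to spare and is lowered by \<open>Ck_open_SucD\<close>, so the induction hypothesis
  covers both summands.\<close>

lemma Ck_open_inner:
  fixes f g :: "'a::euclidean_space \<Rightarrow> 'b::real_inner"
  assumes "open U" "Ck_open k U f" "Ck_open k U g"
  shows "Ck_open k U (\<lambda>x. f x \<bullet> g x)"
  using assms(2,3)
proof (induction k arbitrary: f g)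
  case 0
  then show ?case by (auto intro!: continuous_intros)
next
  case (Suc k)
  have "Ck_open k U (\<lambda>x. frechet_derivative (\<lambda>x. f x \<bullet> g x) (at x) v)" for v
  proof (rule Ck_open_cong[OF assms(1)])
    show "Ck_open k U (\<lambda>x. f x \<bullet> frechet_derivative g (at x) v
        + frechet_derivative f (at x) v \<bullet> g x)"
      using Suc.prems Ck_open_SucD by (intro Ck_open_add assms(1) Suc.IH) auto
  qed (use Suc.prems in \<open>auto simp: frechet_derivative_inner\<close>)
  then show ?case using Suc.prems by (auto simp: frechet_derivative_inner)
qed

lemma frechet_derivative_compose_linear:
  assumes "bounded_linear L" "f differentiable (at (L x))"
  shows "(\<lambda>x. f (L x)) differentiable (at x)"
    and "frechet_derivative (\<lambda>x. f (L x)) (at x) v = frechet_derivative f (at (L x)) (L v)"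
proof -
  have "((\<lambda>x. f (L x)) has_derivative (\<lambda>v. frechet_derivative f (at (L x)) (L v))) (at x)"
    using has_derivative_compose[OF bounded_linear_imp_has_derivative[OF assms(1)]] assms(2)
    by (simp add: frechet_derivative_works)
  then show "(\<lambda>x. f (L x)) differentiable (at x)"
    "frechet_derivative (\<lambda>x. f (L x)) (at x) v = frechet_derivative f (at (L x)) (L v)"
    by (simp_all add: differentiable_def frechet_derivative_at[symmetric] exI)
qed

text \<open>The derivative of the composite in direction \<open>v\<close> is the derivative of
  \<open>f\<close> in the fixed direction \<open>L v\<close>, again composed with
  \<open>L\<close>.\<close>

lemma Ck_open_compose_linear:
  assumes "bounded_linear L" "Ck_open k UNIV f"
  shows "Ck_open k UNIV (\<lambda>x. f (L x))"
  using assms(2)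
proof (induction k arbitrary: f)
  case 0
  then show ?case
    using assms(1) by (auto intro: continuous_on_compose2 linear_continuous_on)
next
  case (Suc k)
  have "Ck_open k UNIV (\<lambda>x. frechet_derivative f (at (L x)) (L v))" for v
    using Suc.prems by (intro Suc.IH) auto
  then show ?case
    using Suc.prems by (simp add: frechet_derivative_compose_linear[OF assms(1)])
qed


section \<open>Iterated directional derivatives\<close>

lemma Ck_open_iter_deriv:
  "Ck_open (m + length vs) U f \<Longrightarrow> Ck_open m U (iter_deriv UNIV vs f)"
proof (induction vs arbitrary: m)
  case (Cons v vs)
  then have "Ck_open (Suc m) U (iter_deriv UNIV vs f)"
    by (intro Cons.IH) (simp only: list.size add_Suc_right add_Suc add_0_right)
  then show ?case by simp
qed simp

lemma Ck_open_mono: "m \<le> k \<Longrightarrow> Ck_open k U f \<Longrightarrow> Ck_open m U f"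
  by (induction k rule: dec_induct) (auto dest: Ck_open_SucD simp del: Ck_open.simps)

lemma iter_deriv_differentiable:
  assumes "Ck_open k U f" "length vs < k" "x \<in> U"
  shows "iter_deriv UNIV vs f differentiable (at x)"
proof -
  have "Ck_open (Suc 0 + length vs) U f"
    using assms by (intro Ck_open_mono[OF _ assms(1)]) simp
  then show ?thesis using Ck_open_iter_deriv assms(3) by fastforce
qed

text \<open>The last entry of a list is the direction differentiated first, so a list ending in
  \<open>v\<close> acts on the derivative in direction \<open>v\<close>.\<close>

lemma iter_deriv_append: "iter_deriv S (vs @ ws) f = iter_deriv S vs (iter_deriv S ws f)"
  by (induction vs) auto

text \<open>This is the condition under which derivatives within a set are unique: arbitrarily small
  steps along each axis stay in the set. The sign of \<open>d\<close> is free, so boundary points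
  are allowed.\<close>

definition axis_accessible :: "'a::euclidean_space set \<Rightarrow> bool" where
  "axis_accessible S \<longleftrightarrow>
     (\<forall>x\<in>S. \<forall>i\<in>Basis. \<forall>e>0. \<exists>d. 0 < \<bar>d\<bar> \<and> \<bar>d\<bar> < e \<and> x + d *\<^sub>R i \<in> S)"

lemma axis_accessible_UNIV: "axis_accessible UNIV"
  unfolding axis_accessible_def
proof (intro ballI allI impI)
  show "\<exists>d. 0 < \<bar>d\<bar> \<and> \<bar>d\<bar> < e \<and> x + d *\<^sub>R i \<in> UNIV" if "0 < e" for x i :: 'a and e :: real
    using that by (intro exI[of _ "e / 2"]) simp
qed

lemma frechet_derivative_within_unique:
  assumes "axis_accessible S" "x \<in> S" "(f has_derivative D) (at x within S)"
  shows "frechet_derivative f (at x within S) = D"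
proof (rule frechet_derivative_unique_within[OF _ assms(3)])
  show "(f has_derivative frechet_derivative f (at x within S)) (at x within S)"
    using frechet_derivative_works[THEN iffD1] differentiableI[OF assms(3)] .
qed (use assms(1,2) in \<open>auto simp: axis_accessible_def\<close>)

text \<open>By induction the lower derivatives agree on all of \<open>U \<inter> S\<close>, hence
  near \<open>x\<close> within \<open>S\<close>. The full derivative of the extension is then a
  derivative within \<open>S\<close>, and uniqueness identifies the two.\<close>

lemma iter_deriv_local_extension:
  fixes f g :: "'a::euclidean_space \<Rightarrow> 'b::real_normed_vector"
  assumes "axis_accessible S"
    and "open U" "Ck_open k U g" "\<And>y. y \<in> U \<inter> S \<Longrightarrow> g y = f y" "length vs \<le> k" "x \<in> U \<inter> S"
  shows "iter_deriv S vs f x = iter_deriv UNIV vs g x"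
  using assms(5,6)
proof (induction vs arbitrary: x)
  case (Cons v vs)
  define D where "D = frechet_derivative (iter_deriv UNIV vs g) (at x)"
  have "(iter_deriv UNIV vs g has_derivative D) (at x within S)"
    using iter_deriv_differentiable[OF assms(3), of vs x] Cons.prems
    by (auto simp: D_def frechet_derivative_works intro: has_derivative_at_withinI)
  moreover obtain e where "e > 0" "ball x e \<subseteq> U"
    using assms(2) Cons.prems(2) open_contains_ball by blast
  ultimately have "(iter_deriv S vs f has_derivative D) (at x within S)"
  proof (elim has_derivative_transform_within)
    show "iter_deriv UNIV vs g y = iter_deriv S vs f y" if "y \<in> S" "dist y x < e" for y
      using Cons.IH[of y] Cons.prems(1) that \<open>ball x e \<subseteq> U\<close>
      by (simp add: subset_iff dist_commute)
  qed (use Cons.prems in auto)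
  then have "frechet_derivative (iter_deriv S vs f) (at x within S) = D"
    using Cons.prems(2) by (intro frechet_derivative_within_unique[OF assms(1)]) auto
  then show ?case by (simp add: D_def)
qed (use assms(4) in auto)

lemma continuous_on_iter_deriv:
  assumes "axis_accessible S" "Ck_on k S f" "length vs \<le> k"
  shows "continuous_on S (iter_deriv S vs f)"
proof (rule iffD2[OF continuous_on_eq_continuous_within], rule ballI)
  fix x assume "x \<in> S"
  then obtain U g where U: "open U" "x \<in> U" "Ck_open k U g" "\<And>y. y \<in> U \<inter> S \<Longrightarrow> g y = f y"
    using assms(2)[unfolded Ck_on_def, rule_format, OF \<open>x \<in> S\<close>] by auto
  \<comment> \<open>Order \<open>0\<close> remaining after \<open>length vs\<close> differentiations
    means continuity.\<close>
  have "Ck_open (0 + length vs) U g" using Ck_open_mono[OF _ U(3)] assms(3) by simp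
  then have "continuous_on U (iter_deriv UNIV vs g)"
    by (metis Ck_open_iter_deriv Ck_open.simps(1))
  then have "continuous (at x within S) (iter_deriv UNIV vs g)"
    using U(1,2) by (simp add: continuous_at_imp_continuous_at_within continuous_on_eq_continuous_at)
  moreover obtain e where "e > 0" "ball x e \<subseteq> U" using U(1,2) open_contains_ball by blast
  ultimately show "continuous (at x within S) (iter_deriv S vs f)"
    using iter_deriv_local_extension[OF assms(1) U(1,3,4) assms(3)] \<open>x \<in> S\<close>
    by (intro continuous_transform_within[where g = "iter_deriv S vs f" and \<delta> = e])
      (auto simp: dist_commute subset_iff)
qed

section \<open>Rules and bounds for iterated derivatives on the whole space\<close>

lemma iter_deriv_lincomb:
  assumes "Ck_open k UNIV f" "Ck_open k UNIV g" "length vs \<le> k"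
  shows "iter_deriv UNIV vs (\<lambda>x. a *\<^sub>R f x + b *\<^sub>R g x) =
    (\<lambda>x. a *\<^sub>R iter_deriv UNIV vs f x + b *\<^sub>R iter_deriv UNIV vs g x)"
  using assms(3)
proof (induction vs)
  case (Cons v vs)
  then show ?case
    using iter_deriv_differentiable[OF assms(1), of vs] iter_deriv_differentiable[OF assms(2), of vs]
    by (auto simp: frechet_derivative_lincomb)
qed simp

lemma iter_deriv_add:
  assumes "Ck_open k UNIV f" "Ck_open k UNIV g" "length vs \<le> k"
  shows "iter_deriv UNIV vs (\<lambda>x. f x + g x) =
    (\<lambda>x. iter_deriv UNIV vs f x + iter_deriv UNIV vs g x)"
  using iter_deriv_lincomb[OF assms, of 1 1] by simp

lemma iter_deriv_diff:
  assumes "Ck_open k UNIV f" "Ck_open k UNIV g" "length vs \<le> k"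
  shows "iter_deriv UNIV vs (\<lambda>x. f x - g x) =
    (\<lambda>x. iter_deriv UNIV vs f x - iter_deriv UNIV vs g x)"
  using iter_deriv_lincomb[OF assms, of 1 "-1"] by simp

lemma iter_deriv_scaleR:
  assumes "Ck_open k UNIV f" "length vs \<le> k"
  shows "iter_deriv UNIV vs (\<lambda>x. a *\<^sub>R f x) = (\<lambda>x. a *\<^sub>R iter_deriv UNIV vs f x)"
  using iter_deriv_lincomb[OF assms(1,1,2), of a 0] by simp

lemma iter_deriv_compose_linear:
  assumes "bounded_linear L" "Ck_open k UNIV f" "length vs \<le> k"
  shows "iter_deriv UNIV vs (\<lambda>x. f (L x)) = (\<lambda>x. iter_deriv UNIV (map L vs) f (L x))"
  using assms(3)
proof (induction vs)
  case (Cons v vs)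
  then show ?case
    using iter_deriv_differentiable[OF assms(2), of "map L vs"]
    by (auto simp: frechet_derivative_compose_linear[OF assms(1)])
qed simp

text \<open>A derivative is linear in its direction, and later derivatives of the zero function
  vanish. This handles basis vectors of the plane killed by a coordinate projection.\<close>

lemma iter_deriv_zero_direction:
  assumes "Ck_open k UNIV f" "length vs \<le> k" "0 \<in> set vs"
  shows "iter_deriv UNIV vs f = (\<lambda>x. 0)"
  using assms(2,3)
proof (induction vs)
  case (Cons v vs)
  show ?case
  proof (cases "v = 0")
    case True
    then show ?thesis
      using iter_deriv_differentiable[OF assms(1), of vs] Cons.prems
      by (auto simp: linear_0 linear_frechet_derivative)
  next
    case False
    then show ?thesis using Cons by auto
  qed
qed simp

text \<open>A crude Leibniz rule: every differentiation doubles the number of terms, and each term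
  is at most \<open>M * N\<close> by Cauchy-Schwarz. The induction removes the last list entry,
  which is differentiated first, and lowers \<open>k\<close> by one.\<close>

lemma norm_iter_deriv_inner_le:
  fixes f g :: "'a::euclidean_space \<Rightarrow> 'b::real_inner"
  assumes "Ck_open k UNIV f" "Ck_open k UNIV g" "length vs \<le> k" "set vs \<subseteq> B"
    and "\<And>ws. set ws \<subseteq> B \<Longrightarrow> length ws \<le> k \<Longrightarrow> norm (iter_deriv UNIV ws f x) \<le> M"
    and "\<And>ws. set ws \<subseteq> B \<Longrightarrow> length ws \<le> k \<Longrightarrow> norm (iter_deriv UNIV ws g x) \<le> N"
  shows "norm (iter_deriv UNIV vs (\<lambda>x. f x \<bullet> g x) x) \<le> 2 ^ length vs * (M * N)"
  using assms
proof (induction vs arbitrary: f g k rule: rev_induct)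
  case Nil
  have "\<bar>f x \<bullet> g x\<bar> \<le> norm (f x) * norm (g x)" by (rule Cauchy_Schwarz_ineq2)
  also have "\<dots> \<le> M * N"
    using Nil(5)[of "[]"] Nil(6)[of "[]"] by (intro mult_mono) (auto intro: order_trans[OF norm_ge_zero])
  finally show ?case by simp
next
  case (snoc v vs)
  then obtain m where k: "k = Suc m" by (cases k) auto
  define f' where "f' = (\<lambda>x. frechet_derivative f (at x) v)"
  define g' where "g' = (\<lambda>x. frechet_derivative g (at x) v)"
  have Ck: "Ck_open m UNIV f'" "Ck_open m UNIV g'" "Ck_open m UNIV f" "Ck_open m UNIV g"
    using snoc.prems(1,2) Ck_open_SucD[of m UNIV f] Ck_open_SucD[of m UNIV g]
    by (auto simp: k f'_def g'_def)
  \<comment> \<open>Derivatives of \<open>f'\<close> and \<open>g'\<close> along \<open>ws\<close>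
    are those of \<open>f\<close> and \<open>g\<close> along \<open>ws @ [v]\<close>, so the same
    constants serve.\<close>
  have bounds: "norm (iter_deriv UNIV ws f' x) \<le> M" "norm (iter_deriv UNIV ws g' x) \<le> N"
    if "set ws \<subseteq> B" "length ws \<le> m" for ws
    using snoc.prems(5)[of "ws @ [v]"] snoc.prems(6)[of "ws @ [v]"] snoc.prems(4) that
    by (auto simp: iter_deriv_append f'_def g'_def k)
  have vs: "length vs \<le> m" "set vs \<subseteq> B" using snoc.prems(3,4) k by auto
  have "iter_deriv UNIV (vs @ [v]) (\<lambda>x. f x \<bullet> g x)
      = iter_deriv UNIV vs (\<lambda>x. f x \<bullet> g' x + f' x \<bullet> g x)"
    using snoc.prems(1,2)
    by (simp add: iter_deriv_append k f'_def g'_def frechet_derivative_inner)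
  also have "\<dots> = (\<lambda>x. iter_deriv UNIV vs (\<lambda>x. f x \<bullet> g' x) x + iter_deriv UNIV vs (\<lambda>x. f' x \<bullet> g x) x)"
    using Ck vs by (intro iter_deriv_add Ck_open_inner) auto
  finally have eq: "iter_deriv UNIV (vs @ [v]) (\<lambda>x. f x \<bullet> g x) x
      = iter_deriv UNIV vs (\<lambda>x. f x \<bullet> g' x) x + iter_deriv UNIV vs (\<lambda>x. f' x \<bullet> g x) x"
    by simp
  have "norm (iter_deriv UNIV vs (\<lambda>x. f x \<bullet> g' x) x) \<le> 2 ^ length vs * (M * N)"
    by (rule snoc.IH[OF Ck(3,2) vs]) (use bounds snoc.prems(5) k in auto)
  moreover have "norm (iter_deriv UNIV vs (\<lambda>x. f' x \<bullet> g x) x) \<le> 2 ^ length vs * (M * N)"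
    by (rule snoc.IH[OF Ck(1,4) vs]) (use bounds snoc.prems(6) k in auto)
  ultimately show ?case unfolding eq
    by (intro order_trans[OF norm_triangle_ineq]) simp
qed


section \<open>Neighbourhoods given by arbitrary compact sets\<close>

text \<open>The generating neighbourhoods require \<open>K\<close> to lie in a domain of
  injectivity. A general compact \<open>K\<close> is cut into finitely many compact pieces, each
  inside such a domain, and the neighbourhoods of the pieces are intersected.\<close>

lemma openin_Ck_nbhd:
  fixes p :: "'a::euclidean_space \<Rightarrow> 'm" and f :: "'m \<Rightarrow> 'b::real_normed_vector"
  assumes inj: "\<And>x. x \<in> S \<Longrightarrow> \<exists>r>0. inj_on p (S \<inter> ball x r)"
    and "f \<in> Ck_maps k S p M" "compact K" "K \<subseteq> S" "0 < \<epsilon>"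
  shows "openin (whitney_topology k S p M) (Ck_nbhd k S p M f K \<epsilon>)"
proof -
  obtain r where r: "\<And>x. x \<in> S \<Longrightarrow> r x > 0 \<and> inj_on p (S \<inter> ball x (r x))"
    using inj by metis
  \<comment> \<open>With half the radius, the closed balls still lie in the open balls on which
    \<open>p\<close> is injective.\<close>
  have "K \<subseteq> (\<Union>x\<in>K. ball x (r x / 2))" using r assms(4) by force
  then obtain F where F: "F \<subseteq> K" "finite F" "K \<subseteq> (\<Union>x\<in>F. ball x (r x / 2))"
    using compactE_image[OF assms(3), of K "\<lambda>x. ball x (r x / 2)"] by auto
  have op: "openin (whitney_topology k S p M) (Ck_nbhd k S p M f (K \<inter> cball x (r x / 2)) \<epsilon>)"
    if "x \<in> F" for x
  proof -
    have "r x > 0" "inj_on p (S \<inter> ball x (r x))" using r that F(1) assms(4) by auto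
    moreover have "openin (top_of_set S) (S \<inter> ball x (r x))" by auto
    moreover have "compact (K \<inter> cball x (r x / 2))" using assms(3) by auto
    moreover have "K \<inter> cball x (r x / 2) \<subseteq> S \<inter> ball x (r x)"
      using assms(4) \<open>r x > 0\<close> by auto
    ultimately show ?thesis
      unfolding whitney_topology_def using assms(2,5)
      by (intro topology_generated_by_Basis) blast
  qed
  \<comment> \<open>The factor \<open>topspace\<close> matters when \<open>F\<close> is empty, since
    the intersection over \<open>F\<close> is then the whole type.\<close>
  have "Ck_nbhd k S p M f K \<epsilon> =
      topspace (whitney_topology k S p M) \<inter> (\<Inter>x\<in>F. Ck_nbhd k S p M f (K \<inter> cball x (r x / 2)) \<epsilon>)"
    unfolding topspace_whitney_topology
  proof (intro equalityI subsetI)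
    fix g assume g: "g \<in> Ck_maps k S p M \<inter> (\<Inter>x\<in>F. Ck_nbhd k S p M f (K \<inter> cball x (r x / 2)) \<epsilon>)"
    have "norm (iter_deriv S vs (g \<circ> p) y - iter_deriv S vs (f \<circ> p) y) < \<epsilon>"
      if vs: "set vs \<subseteq> Basis" "length vs \<le> k" and y: "y \<in> K" for vs y
    proof -
      obtain x where "x \<in> F" "y \<in> K \<inter> cball x (r x / 2)" using F(3) y by fastforce
      then show ?thesis using g vs by (auto simp: Ck_nbhd_def)
    qed
    then show "g \<in> Ck_nbhd k S p M f K \<epsilon>" using g by (auto simp: Ck_nbhd_def)
  qed (auto simp: Ck_nbhd_def)
  moreover have "openin (whitney_topology k S p M)
      (topspace (whitney_topology k S p M) \<inter> (\<Inter>x\<in>F. Ck_nbhd k S p M f (K \<inter> cball x (r x / 2)) \<epsilon>))"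
    using F(2) op
    by (induction F) (auto simp: Int_left_commute[of "topspace _"] intro: openin_Int)
  ultimately show ?thesis by simp
qed

text \<open>Maxima over compact sets are attained, so a strict bound leaves a positive margin; if
  there are no values at all, any number below \<open>c\<close> serves.\<close>

lemma compact_family_upper_bound:
  fixes h :: "'i \<Rightarrow> 'a::topological_space \<Rightarrow> real"
  assumes "finite A" "compact K" "\<And>a. a \<in> A \<Longrightarrow> continuous_on K (h a)"
    and "\<And>a x. a \<in> A \<Longrightarrow> x \<in> K \<Longrightarrow> h a x < c"
  shows "\<exists>m<c. \<forall>a\<in>A. \<forall>x\<in>K. h a x \<le> m"
proof (cases "(\<Union>a\<in>A. h a ` K) = {}")
  case True
  then show ?thesis using lt_ex[of c] by auto
next
  case False
  have "compact (\<Union>a\<in>A. h a ` K)"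
    using assms by (intro compact_UN compact_continuous_image) auto
  with False obtain m where "m \<in> (\<Union>a\<in>A. h a ` K)" "\<forall>t\<in>(\<Union>a\<in>A. h a ` K). t \<le> m"
    using compact_attains_sup by meson
  then show ?thesis using assms(4) by (intro exI[of _ m]) auto
qed

lemma compact_family_bounded:
  fixes h :: "'i \<Rightarrow> 'a::topological_space \<Rightarrow> 'b::real_normed_vector"
  assumes "finite A" "compact K" "\<And>a. a \<in> A \<Longrightarrow> continuous_on K (h a)"
  shows "\<exists>M>0. \<forall>a\<in>A. \<forall>x\<in>K. norm (h a x) \<le> M"
proof -
  have "bounded (\<Union>a\<in>A. h a ` K)"
    using assms by (intro compact_imp_bounded compact_UN compact_continuous_image) auto
  then show ?thesis unfolding bounded_pos by auto
qed


section \<open>The circle and the strip\<close>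

text \<open>Parameters of the same point differ by an integer, and two parameters in this ball
  differ by less than \<open>1\<close>.\<close>

lemma circ_exp_locally_inj: "inj_on circ_exp (ball x (1/2))"
proof (rule inj_onI)
  fix s t assume st: "s \<in> ball x (1/2)" "t \<in> ball x (1/2)" "circ_exp s = circ_exp t"
  obtain n :: int where
    "2 * of_real pi * \<i> * of_real s = 2 * of_real pi * \<i> * of_real t + of_real (of_int (2 * n) * pi) * \<i>"
    using st(3) unfolding circ_exp_def exp_eq by blast
  then have "2 * pi * s = 2 * pi * t + of_int (2 * n) * pi"
    by (simp add: complex_eq_iff)
  then have "pi * (s - t - of_int n) = 0" by (simp add: algebra_simps)
  then have n: "s - t = of_int n" by simp
  moreover have "\<bar>s - t\<bar> < 1" using st(1,2) unfolding mem_ball dist_real_def by linarith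
  ultimately have "n = 0" by linarith
  then show "s = t" using n by simp
qed

lemma circ_exp_in_S1: "circ_exp t \<in> S1"
  using circ_exp_surj by blast

lemma axis_accessible_strip: "axis_accessible strip"
  unfolding axis_accessible_def
proof (intro ballI allI impI)
  fix x i :: "real \<times> real" and e :: real
  assume xs: "x \<in> strip" and i: "i \<in> Basis" and e: "0 < e"
  obtain a b where x: "x = (a, b)" "0 \<le> b - a" "b - a \<le> 1"
    using xs by (auto simp: strip_def)
  \<comment> \<open>A step along an axis changes \<open>b - a\<close> by \<open>d\<close> up to
    sign. As \<open>d\<close> is at most half the length of the interval from \<open>0\<close> to
    \<open>1\<close>, at least one of the two signs keeps \<open>b - a\<close> inside.\<close>
  define d where "d = min (e/2) (1/2)"
  have d: "0 < d" "d < e" "d \<le> 1/2" using e by (auto simp: d_def)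
  have "x + d *\<^sub>R i \<in> strip \<or> x + (- d) *\<^sub>R i \<in> strip"
    using i x d by (auto simp: Basis_prod_def strip_def)
  then show "\<exists>d. 0 < \<bar>d\<bar> \<and> \<bar>d\<bar> < e \<and> x + d *\<^sub>R i \<in> strip"
    using d by (metis abs_minus_cancel abs_of_pos)
qed

section \<open>Half squared chords: the map in covering coordinates\<close>

definition half_sq_chord :: "(real \<Rightarrow> 'b::real_inner) \<Rightarrow> real \<times> real \<Rightarrow> real" where
  "half_sq_chord u x = 1 / 2 * (norm (u (fst x) - u (snd x)))\<^sup>2"

lemma T_map_F2_cover: "T_map \<gamma> \<circ> F2_cover = half_sq_chord (\<gamma> \<circ> circ_exp)"
  by (auto simp: fun_eq_iff F2_cover_def half_sq_chord_def
    T_map_pair[OF circ_exp_in_S1 circ_exp_in_S1])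

lemma Ck_open_chord:
  "Ck_open k UNIV u \<Longrightarrow> Ck_open k UNIV (\<lambda>x::real \<times> real. u (fst x) - u (snd x))"
  using Ck_open_compose_linear[OF bounded_linear_fst] Ck_open_compose_linear[OF bounded_linear_snd]
  by (intro Ck_open_diff open_UNIV)

lemma half_sq_chord_eq:
  "half_sq_chord u = (\<lambda>x. (1/2) *\<^sub>R ((u (fst x) - u (snd x)) \<bullet> (u (fst x) - u (snd x))))"
  by (auto simp: half_sq_chord_def power2_norm_eq_inner)

lemma Ck_open_half_sq_chord:
  assumes "Ck_open k UNIV u"
  shows "Ck_open k UNIV (half_sq_chord u)"
proof -
  let ?g = "\<lambda>x::real \<times> real. (u (fst x) - u (snd x)) \<bullet> (u (fst x) - u (snd x))"
  have "Ck_open k UNIV ?g"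
    using assms by (intro Ck_open_inner Ck_open_chord) auto
  from Ck_open_lincomb[OF open_UNIV this this, of "1/2" 0] show ?thesis
    by (simp add: half_sq_chord_eq)
qed

text \<open>Here \<open>L\<close> stands for a coordinate projection of the plane. A list of basis
  vectors either contains one sent to \<open>0\<close>, and the derivative vanishes, or is sent to a
  list of ones, giving a derivative of \<open>u\<close> itself.\<close>

lemma norm_iter_deriv_compose_le:
  assumes "bounded_linear L" "\<And>b. b \<in> Basis \<Longrightarrow> L b \<in> {0, 1::real}"
    and "Ck_open k UNIV u" "length vs \<le> k" "set vs \<subseteq> Basis"
    and "\<And>ws. set ws \<subseteq> Basis \<Longrightarrow> length ws \<le> k \<Longrightarrow> norm (iter_deriv UNIV ws u (L x)) \<le> M"
  shows "norm (iter_deriv UNIV vs (\<lambda>x. u (L x)) x) \<le> M"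
proof (cases "0 \<in> set (map L vs)")
  case True
  moreover have "M \<ge> 0" using order_trans[OF norm_ge_zero assms(6)[of "[]"]] by simp
  ultimately show ?thesis
    using iter_deriv_zero_direction[OF assms(3), of "map L vs"] assms(4)
    by (simp add: iter_deriv_compose_linear[OF assms(1,3,4)])
next
  case False
  then have "set (map L vs) \<subseteq> Basis" using assms(2,5) by force
  then show ?thesis
    using assms(4) assms(6)[of "map L vs"] by (simp add: iter_deriv_compose_linear[OF assms(1,3,4)])
qed

lemma norm_iter_deriv_chord_le:
  assumes "Ck_open k UNIV u" "length vs \<le> k" "set vs \<subseteq> Basis"
    and "\<And>ws t. set ws \<subseteq> Basis \<Longrightarrow> length ws \<le> k \<Longrightarrow> t \<in> {fst x, snd x} \<Longrightarrow>
      norm (iter_deriv UNIV ws u t) \<le> M"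
  shows "norm (iter_deriv UNIV vs (\<lambda>x::real \<times> real. u (fst x) - u (snd x)) x) \<le> 2 * M"
proof -
  have "norm (iter_deriv UNIV vs (\<lambda>x. u (fst x)) x) \<le> M"
    by (rule norm_iter_deriv_compose_le[OF bounded_linear_fst _ assms(1-3)])
      (use assms(4) in \<open>auto simp: Basis_prod_def\<close>)
  moreover have "norm (iter_deriv UNIV vs (\<lambda>x. u (snd x)) x) \<le> M"
    by (rule norm_iter_deriv_compose_le[OF bounded_linear_snd _ assms(1-3)])
      (use assms(4) in \<open>auto simp: Basis_prod_def\<close>)
  moreover have "iter_deriv UNIV vs (\<lambda>x::real \<times> real. u (fst x) - u (snd x))
      = (\<lambda>x. iter_deriv UNIV vs (\<lambda>x. u (fst x)) x - iter_deriv UNIV vs (\<lambda>x. u (snd x)) x)"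
    using assms(1,2) Ck_open_compose_linear[OF bounded_linear_fst]
      Ck_open_compose_linear[OF bounded_linear_snd]
    by (intro iter_deriv_diff)
  ultimately show ?thesis
    by (auto intro!: order_trans[OF norm_triangle_ineq4])
qed

text \<open>The constant combines the factor \<open>1/2\<close> from polarisation, at most
  \<open>2 ^ k\<close> from the Leibniz bound, and a factor \<open>2\<close> for each of the two
  chords.\<close>

lemma norm_iter_deriv_half_sq_chord_diff_le:
  fixes u w :: "real \<Rightarrow> 'b::real_inner"
  assumes "Ck_open k UNIV u" "Ck_open k UNIV w" "length vs \<le> k" "set vs \<subseteq> Basis"
    and "\<And>ws t. set ws \<subseteq> Basis \<Longrightarrow> length ws \<le> k \<Longrightarrow> t \<in> {fst x, snd x} \<Longrightarrow>
      norm (iter_deriv UNIV ws w t) \<le> M"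
    and "\<And>ws t. set ws \<subseteq> Basis \<Longrightarrow> length ws \<le> k \<Longrightarrow> t \<in> {fst x, snd x} \<Longrightarrow>
      norm (iter_deriv UNIV ws u t - iter_deriv UNIV ws w t) \<le> \<eta>"
  shows "norm (iter_deriv UNIV vs (half_sq_chord u) x - iter_deriv UNIV vs (half_sq_chord w) x)
    \<le> 2 ^ Suc k * ((2 * M + \<eta>) * \<eta>)"
proof -
  define s where "s = (\<lambda>t. u t + w t)"
  define d where "d = (\<lambda>t. u t - w t)"
  define chord where "chord = (\<lambda>(v :: real \<Rightarrow> 'b) (x::real \<times> real). v (fst x) - v (snd x))"
  have Ck: "Ck_open k UNIV s" "Ck_open k UNIV d"
    using assms(1,2) by (auto simp: s_def d_def intro: Ck_open_add Ck_open_diff)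
  have d_le: "norm (iter_deriv UNIV ws d t) \<le> \<eta>"
    if "set ws \<subseteq> Basis" "length ws \<le> k" "t \<in> {fst x, snd x}" for ws t
    using assms(6)[OF that] iter_deriv_diff[OF assms(1,2) that(2)] by (simp add: d_def)
  have s_le: "norm (iter_deriv UNIV ws s t) \<le> 2 * M + \<eta>"
    if "set ws \<subseteq> Basis" "length ws \<le> k" "t \<in> {fst x, snd x}" for ws t
  proof -
    \<comment> \<open>Writing \<open>u + w\<close> as \<open>(u - w) + 2 w\<close> avoids a separate
      bound on \<open>u\<close>.\<close>
    have "iter_deriv UNIV ws s t = (iter_deriv UNIV ws u t - iter_deriv UNIV ws w t)
        + (iter_deriv UNIV ws w t + iter_deriv UNIV ws w t)"
      using iter_deriv_add[OF assms(1,2) that(2)] by (simp add: s_def)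
    also have "norm \<dots> \<le> \<eta> + (M + M)"
      using assms(5,6)[OF that] by (intro norm_triangle_mono) auto
    finally show ?thesis by simp
  qed
  \<comment> \<open>Polarisation: the difference of two squared norms is the inner product of sum
    and difference, and chords are additive in the function.\<close>
  have "half_sq_chord u y - half_sq_chord w y = (1/2) *\<^sub>R (chord s y \<bullet> chord d y)" for y
    by (simp add: half_sq_chord_eq chord_def s_def d_def algebra_simps inner_commute)
  then have "(\<lambda>y. half_sq_chord u y - half_sq_chord w y) = (\<lambda>y. (1/2) *\<^sub>R (chord s y \<bullet> chord d y))"
    by auto
  moreover have Ck': "Ck_open k UNIV (chord s)" "Ck_open k UNIV (chord d)"
    using Ck by (auto simp: chord_def intro: Ck_open_chord)
  ultimately have eq: "iter_deriv UNIV vs (half_sq_chord u) x - iter_deriv UNIV vs (half_sq_chord w) x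
      = (1/2) *\<^sub>R iter_deriv UNIV vs (\<lambda>y. chord s y \<bullet> chord d y) x"
    using fun_cong[OF iter_deriv_diff[OF Ck_open_half_sq_chord Ck_open_half_sq_chord, OF assms(1-3)], of x]
      fun_cong[OF iter_deriv_scaleR[OF Ck_open_inner[OF open_UNIV Ck'] assms(3), of "1/2"], of x]
    by simp
  have chord_le: "norm (iter_deriv UNIV ws (chord s) x) \<le> 2 * (2 * M + \<eta>)"
    "norm (iter_deriv UNIV ws (chord d) x) \<le> 2 * \<eta>"
    if "set ws \<subseteq> Basis" "length ws \<le> k" for ws
    unfolding chord_def
    by (rule norm_iter_deriv_chord_le[OF Ck(1) that(2,1) s_le]
          norm_iter_deriv_chord_le[OF Ck(2) that(2,1) d_le]; assumption)+
  have "norm (iter_deriv UNIV vs (\<lambda>y. chord s y \<bullet> chord d y) x)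
      \<le> 2 ^ length vs * ((2 * (2 * M + \<eta>)) * (2 * \<eta>))"
    using chord_le by (rule norm_iter_deriv_inner_le[OF Ck' assms(3,4)])
  then have "norm (iter_deriv UNIV vs (half_sq_chord u) x - iter_deriv UNIV vs (half_sq_chord w) x)
      \<le> 2 ^ length vs * (2 * ((2 * M + \<eta>) * \<eta>))"
    unfolding eq by (simp add: algebra_simps)
  also have "\<dots> \<le> 2 ^ k * (2 * ((2 * M + \<eta>) * \<eta>))"
  proof (rule mult_right_mono)
    \<comment> \<open>The bounds for the empty list dominate a norm, hence are nonnegative.\<close>
    have "0 \<le> \<eta>" "0 \<le> 2 * M + \<eta>"
      using order_trans[OF norm_ge_zero d_le[of "[]" "fst x"]]
        order_trans[OF norm_ge_zero s_le[of "[]" "fst x"]] by auto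
    then show "0 \<le> 2 * ((2 * M + \<eta>) * \<eta>)" by simp
  qed (use assms(3) in simp)
  also have "\<dots> = 2 ^ Suc k * ((2 * M + \<eta>) * \<eta>)"
    by (simp only: power_Suc2 mult.assoc)
  finally show ?thesis .
qed

section \<open>Continuity of the map between spaces of \<open>C\<^sup>k\<close> functions\<close>

lemma T_map_in_Ck_maps:
  assumes "\<gamma> \<in> Ck_maps k UNIV circ_exp S1"
  shows "T_map \<gamma> \<in> Ck_maps k strip F2_cover F2"
proof -
  have "Ck_open k UNIV (half_sq_chord (\<gamma> \<circ> circ_exp))"
    using assms by (intro Ck_open_half_sq_chord Ck_on_UNIV_imp_Ck_open) (simp add: Ck_maps_def)
  \<comment> \<open>The lift is \<open>C\<^sup>k\<close> on the whole plane, so it is its own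
    extension near every point of the strip.\<close>
  then have "Ck_on k strip (T_map \<gamma> \<circ> F2_cover)"
    unfolding T_map_F2_cover Ck_on_def by blast
  then show ?thesis by (simp add: Ck_maps_def T_map_def)
qed

text \<open>Compactness of \<open>K\<close> turns the strict bound at \<gamma> into a margin
  \<open>\<epsilon> - m\<close>, and closeness to \<gamma> on a compact set of parameters moves the
  image by less than this margin.\<close>

lemma T_map_nbhd:
  fixes \<gamma> :: "complex \<Rightarrow> real ^ 'd::finite"
  assumes \<gamma>: "\<gamma> \<in> Ck_maps k UNIV circ_exp S1" and f: "f \<in> Ck_maps k strip F2_cover F2"
    and K: "compact K" "K \<subseteq> strip" and T\<gamma>: "T_map \<gamma> \<in> Ck_nbhd k strip F2_cover F2 f K \<epsilon>"
  obtains C \<eta> where "compact C" "0 < \<eta>"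
    "T_map ` Ck_nbhd k UNIV circ_exp S1 \<gamma> C \<eta> \<subseteq> Ck_nbhd k strip F2_cover F2 f K \<epsilon>"
proof -
  define A :: "(real \<times> real) list set" where "A = {vs. set vs \<subseteq> Basis \<and> length vs \<le> k}"
  define A' :: "real list set" where "A' = {vs. set vs \<subseteq> Basis \<and> length vs \<le> k}"
  have fin: "finite A" "finite A'"
    unfolding A_def A'_def by (rule finite_lists_length_le, simp)+
  define w where "w = \<gamma> \<circ> circ_exp"
  have Ckw: "Ck_open k UNIV w" "Ck_on k UNIV w"
    using \<gamma> by (auto simp: w_def Ck_maps_def intro: Ck_on_UNIV_imp_Ck_open)
  have T\<gamma>_Ck: "T_map \<gamma> \<in> Ck_maps k strip F2_cover F2" by (rule T_map_in_Ck_maps[OF \<gamma>])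
  have cont: "continuous_on K (iter_deriv strip vs (g \<circ> F2_cover))"
    if "vs \<in> A" "g \<in> Ck_maps k strip F2_cover F2" for vs and g :: "complex set \<Rightarrow> real"
    using that K(2)
    by (intro continuous_on_subset[OF continuous_on_iter_deriv[OF axis_accessible_strip]])
      (auto simp: Ck_maps_def A_def)
  have "\<exists>m<\<epsilon>. \<forall>vs\<in>A. \<forall>x\<in>K. norm (iter_deriv strip vs (T_map \<gamma> \<circ> F2_cover) x
      - iter_deriv strip vs (f \<circ> F2_cover) x) \<le> m"
    using T\<gamma> by (intro compact_family_upper_bound fin K(1) continuous_intros cont f T\<gamma>_Ck)
      (auto simp: Ck_nbhd_def A_def)
  then obtain m where m: "m < \<epsilon>" "\<And>vs x. vs \<in> A \<Longrightarrow> x \<in> K \<Longrightarrow>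
      norm (iter_deriv strip vs (T_map \<gamma> \<circ> F2_cover) x - iter_deriv strip vs (f \<circ> F2_cover) x) \<le> m"
    by blast
  \<comment> \<open>Both coordinates of every point of \<open>K\<close> lie in \<open>C\<close>,
    which is all that the chord estimate looks at.\<close>
  define C where "C = fst ` K \<union> snd ` K"
  have C: "compact C"
    using K(1) by (auto simp: C_def intro!: compact_Un compact_continuous_image continuous_intros)
  have "continuous_on C (iter_deriv UNIV vs w)" if "vs \<in> A'" for vs
    using that Ckw(2)
    by (intro continuous_on_subset[OF continuous_on_iter_deriv[OF axis_accessible_UNIV]])
      (auto simp: A'_def)
  then obtain M where M: "M > 0" "\<And>vs t. vs \<in> A' \<Longrightarrow> t \<in> C \<Longrightarrow> norm (iter_deriv UNIV vs w t) \<le> M"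
    using compact_family_bounded[OF fin(2) C, of "\<lambda>vs. iter_deriv UNIV vs w"] by blast
  \<comment> \<open>The cap \<open>1\<close> gives \<open>2 * M + \<eta> \<le> 2 * M + 1\<close>.
    The exponent \<open>Suc (Suc k)\<close> has one factor \<open>2\<close> beyond the chord
    estimate, so the change is at most half the margin and the final inequality is strict.\<close>
  define \<eta> where "\<eta> = min 1 ((\<epsilon> - m) / (2 ^ Suc (Suc k) * (2 * M + 1)))"
  have \<eta>: "0 < \<eta>" "\<eta> \<le> 1" using m(1) M(1) by (auto simp: \<eta>_def)
  have "2 ^ Suc k * ((2 * M + \<eta>) * \<eta>) \<le> 2 ^ Suc k * ((2 * M + 1) * \<eta>)"
    using \<eta> M(1) by (intro mult_left_mono mult_right_mono) auto
  also have "\<dots> \<le> 2 ^ Suc k * ((2 * M + 1) * ((\<epsilon> - m) / (2 ^ Suc (Suc k) * (2 * M + 1))))"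
    using M(1) by (intro mult_left_mono) (auto simp: \<eta>_def)
  also have "\<dots> = (\<epsilon> - m) / 2"
    using M(1) by (simp add: divide_simps)
  also have "\<dots> < \<epsilon> - m" using m(1) by simp
  finally have small: "2 ^ Suc k * ((2 * M + \<eta>) * \<eta>) < \<epsilon> - m" .
  have "T_map \<gamma>' \<in> Ck_nbhd k strip F2_cover F2 f K \<epsilon>"
    if \<gamma>': "\<gamma>' \<in> Ck_nbhd k UNIV circ_exp S1 \<gamma> C \<eta>" for \<gamma>' :: "complex \<Rightarrow> real ^ 'd"
  proof -
    define u where "u = \<gamma>' \<circ> circ_exp"
    have \<gamma>'_Ck: "\<gamma>' \<in> Ck_maps k UNIV circ_exp S1" using \<gamma>' by (simp add: Ck_nbhd_def)
    then have Cku: "Ck_open k UNIV u"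
      by (auto simp: u_def Ck_maps_def intro: Ck_on_UNIV_imp_Ck_open)
    \<comment> \<open>The lift is defined on the whole plane, so its derivatives within the strip,
      boundary included, are ordinary ones.\<close>
    have ext: "iter_deriv strip vs (half_sq_chord v) x = iter_deriv UNIV vs (half_sq_chord v) x"
      if "vs \<in> A" "x \<in> K" "Ck_open k UNIV v" for vs x and v :: "real \<Rightarrow> real ^ 'd"
      using that K(2) Ck_open_half_sq_chord[OF that(3)]
      by (intro iter_deriv_local_extension[where U = UNIV and k = k, OF axis_accessible_strip])
        (auto simp: A_def)
    have "norm (iter_deriv strip vs (T_map \<gamma>' \<circ> F2_cover) x - iter_deriv strip vs (f \<circ> F2_cover) x) < \<epsilon>"
      if "vs \<in> A" "x \<in> K" for vs x
    proof -
      have inC: "{fst x, snd x} \<subseteq> C" using that(2) by (auto simp: C_def)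
      have "norm (iter_deriv UNIV vs (half_sq_chord u) x - iter_deriv UNIV vs (half_sq_chord w) x)
          \<le> 2 ^ Suc k * ((2 * M + \<eta>) * \<eta>)"
        using Cku Ckw(1) that(1) inC M(2) \<gamma>'
        by (intro norm_iter_deriv_half_sq_chord_diff_le)
          (auto simp: A_def A'_def Ck_nbhd_def u_def w_def intro: less_imp_le)
      then have "norm (iter_deriv strip vs (T_map \<gamma>' \<circ> F2_cover) x
          - iter_deriv strip vs (T_map \<gamma> \<circ> F2_cover) x) < \<epsilon> - m"
        using small ext[OF that] Cku Ckw(1) by (simp add: T_map_F2_cover u_def w_def)
      \<comment> \<open>Triangle inequality through \<open>T_map \<gamma>\<close>: less than
        \<open>\<epsilon> - m\<close>, plus at most \<open>m\<close>.\<close>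
      then show ?thesis
        using m(2)[OF that] by simp
    qed
    then show ?thesis
      using T_map_in_Ck_maps[OF \<gamma>'_Ck] by (auto simp: Ck_nbhd_def A_def)
  qed
  then show ?thesis using that[OF C \<eta>(1)] by blast
qed

theorem proposition4p1:
  fixes k :: nat
  shows "continuous_map
           (Ck_S1_topology k :: (complex \<Rightarrow> real ^ 'd::finite) topology)
           (Ck_F2_topology k)
           T_map"
proof -
  let ?X = "Ck_S1_topology k :: (complex \<Rightarrow> real ^ 'd) topology"
  have X: "topspace ?X = Ck_maps k UNIV circ_exp S1"
    by (simp add: Ck_S1_topology_def topspace_whitney_topology)
  have preimage: "openin ?X (T_map -` Ck_nbhd k strip F2_cover F2 f K \<epsilon> \<inter> topspace ?X)"
    if f: "f \<in> Ck_maps k strip F2_cover F2" and K: "compact K" "K \<subseteq> strip" for f K \<epsilon>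
  \<comment> \<open>Openness is checked point by point, since \<open>C\<close> and \<eta> come from
    \<open>T_map_nbhd\<close> at the given \<gamma>.\<close>
  proof (subst openin_subopen, intro ballI)
    fix \<gamma> assume "\<gamma> \<in> T_map -` Ck_nbhd k strip F2_cover F2 f K \<epsilon> \<inter> topspace ?X"
    then have \<gamma>: "\<gamma> \<in> Ck_maps k UNIV circ_exp S1"
      and T\<gamma>: "T_map \<gamma> \<in> Ck_nbhd k strip F2_cover F2 f K \<epsilon>" by (auto simp: X)
    from T_map_nbhd[OF \<gamma> f K T\<gamma>] obtain C \<eta> where C: "compact C" "0 < \<eta>"
      "T_map ` Ck_nbhd k UNIV circ_exp S1 \<gamma> C \<eta> \<subseteq> Ck_nbhd k strip F2_cover F2 f K \<epsilon>" .
    \<comment> \<open>The set \<open>C\<close> may wrap around the circle, so this need not be a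
      generating set; local injectivity of \<open>circ_exp\<close> makes it open
      nevertheless.\<close>
    have "openin ?X (Ck_nbhd k UNIV circ_exp S1 \<gamma> C \<eta>)"
      unfolding Ck_S1_topology_def
    proof (rule openin_Ck_nbhd)
      show "\<exists>r>0. inj_on circ_exp (UNIV \<inter> ball x r)" for x
        using circ_exp_locally_inj[of x] by (intro exI[of _ "1/2"]) simp
    qed (use \<gamma> C in auto)
    moreover have "\<gamma> \<in> Ck_nbhd k UNIV circ_exp S1 \<gamma> C \<eta>"
      using \<gamma> C(2) by (simp add: Ck_nbhd_def)
    moreover have "Ck_nbhd k UNIV circ_exp S1 \<gamma> C \<eta> \<subseteq> topspace ?X"
      by (auto simp: X Ck_nbhd_def)
    ultimately show "\<exists>W. openin ?X W \<and> \<gamma> \<in> W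
        \<and> W \<subseteq> T_map -` Ck_nbhd k strip F2_cover F2 f K \<epsilon> \<inter> topspace ?X"
      using C(3) by blast
  qed
  show ?thesis
    unfolding Ck_F2_topology_def whitney_topology_def[of k strip]
  proof (rule continuous_on_generated_topo, goal_cases)
    case (1 U)
    then obtain f V K \<epsilon> where U: "U = Ck_nbhd k strip F2_cover F2 f K \<epsilon>"
      "f \<in> Ck_maps k strip F2_cover F2" "openin (top_of_set strip) V" "compact K" "K \<subseteq> V"
      by blast
    then have "K \<subseteq> strip" using openin_imp_subset[OF U(3)] by simp
    then show ?case using preimage U by simp
  next
    case 2
    \<comment> \<open>The remaining goal asks that images lie in the union of the generating sets,
      which is the underlying space of the topology.\<close>
    have "T_map ` topspace ?X
        \<subseteq> topspace (whitney_topology k strip F2_cover F2 :: (complex set \<Rightarrow> real) topology)"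
      using T_map_in_Ck_maps by (auto simp: X topspace_whitney_topology)
    then show ?case by (simp only: whitney_topology_def topology_generated_by_topspace)
  qed
qed

end
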